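(* Let $n$ and $r$ be positive integers with $1 \le r < n$. Then the circulant graph $C(2n,r)$ is singular if and only if $\gcd(n, 2r+1) \ge 3$.
   Context: A graph is called singular if its adjacency matrix is singular. For a positive integer $m \ge 3$, $C_m$ denotes the cycle graph on $m$ vertices. For $1 \le r < \lfloor m/2 \rfloor$, $C_m^{(r)}$ is the graph with the same vertex set as $C_m$ in which two distinct vertices $x,y$ are adjacent exactly when the distance between $x$ and $y$ in $C_m$ is at most $r$. The graph $C_{2n}^{n}$ is the graph on the vertex set of $C_{2n}$ in which two vertices are adjacent exactly when their distance in $C_{2n}$ equals $n$. For $1 \le r < n$, $C(2n,r)$ is the graph on $2n$ vertices whose adjacency matrix is the sum of the adjacency matrices of $C_{2n}^{(r)}$ and $C_{2n}^{n}$; equivalently, its adjacency matrix is the circulant matrix (each row is the cyclic shift of the previous one by one position to the right) with first row $[0, \underbrace{1,\ldots,1}_{r}, \underbrace{0,\ldots,0}_{n-r-1}, 1, \underbrace{0,\ldots,0}_{n-r-1}, \underbrace{1,\ldots,1}_{r}]$. *)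

theory Defs
  imports
    "Graph_Theory.Pair_Digraph"
    "Graph_Theory.Shortest_Path"
    "Jordan_Normal_Form.Matrix"
begin

(* Graphs are symmetric loop-free relations on the vertex set {..<m}: pair_graph
   is proved for each of them below. *)

definition cycle_graph :: "nat \<Rightarrow> nat pair_pre_digraph" where
  "cycle_graph m = \<lparr> pverts = {..<m},
     parcs = {(x, y). x < m \<and> y < m \<and> (y = Suc x mod m \<or> x = Suc y mod m)} \<rparr>"

(* \<mu> for unit arc weights is the length of a shortest walk (infinite if there is none). *)
definition graph_dist :: "'a pair_pre_digraph \<Rightarrow> 'a \<Rightarrow> 'a \<Rightarrow> ereal" where
  "graph_dist G x y = wf_digraph.\<mu> (with_proj G) (\<lambda>_. 1) x y"

definition cycle_power :: "nat \<Rightarrow> nat \<Rightarrow> nat pair_pre_digraph" where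
  "cycle_power m r = \<lparr> pverts = {..<m},
     parcs = {(x, y). x < m \<and> y < m \<and> x \<noteq> y \<and>
                      graph_dist (cycle_graph m) x y \<le> ereal (real r)} \<rparr>"

definition antipodal_graph :: "nat \<Rightarrow> nat pair_pre_digraph" where
  "antipodal_graph n = \<lparr> pverts = {..<2 * n},
     parcs = {(x, y). x < 2 * n \<and> y < 2 * n \<and>
                      graph_dist (cycle_graph (2 * n)) x y = ereal (real n)} \<rparr>"

(* The two arc sets are disjoint for r < n, so the adjacency matrix is the sum of the two
   adjacency matrices (lemma adj_matrix_circ_graph_sum). *)
definition circ_graph :: "nat \<Rightarrow> nat \<Rightarrow> nat pair_pre_digraph" where
  "circ_graph n r = \<lparr> pverts = {..<2 * n},
     parcs = parcs (cycle_power (2 * n) r) \<union> parcs (antipodal_graph n) \<rparr>"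

(* Intended for graphs whose vertex set is an initial segment of the natural numbers. *)
definition adj_matrix :: "nat pair_pre_digraph \<Rightarrow> real mat" where
  "adj_matrix G = mat (card (pverts G)) (card (pverts G))
     (\<lambda>(i, j). if (i, j) \<in> parcs G then 1 else 0)"

definition singular_graph :: "nat pair_pre_digraph \<Rightarrow> bool" where
  "singular_graph G \<longleftrightarrow> \<not> invertible_mat (adj_matrix G)"

lemma wf_cycle_graph: "wf_digraph (with_proj (cycle_graph m))"
  by unfold_locales (auto simp: cycle_graph_def)

lemma pair_graph_cycle_graph:
  assumes "3 \<le> m"
  shows "pair_graph (cycle_graph m)"
proof -
  have "parcs (cycle_graph m) \<subseteq> {..<m} \<times> {..<m}"
    by (auto simp: cycle_graph_def)
  then have "finite (parcs (cycle_graph m))"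
    by (rule finite_subset) simp
  then show ?thesis
    using assms
    by unfold_locales
      (auto simp: cycle_graph_def mod_Suc symmetric_def sym_def split: if_splits)
qed

lemma awalk_cycle_graph_forward:
  assumes "x < m"
  shows "\<exists>p. pre_digraph.awalk (with_proj (cycle_graph m)) x p ((x + k) mod m) \<and> length p = k"
proof (induction k)
  case 0
  then show ?case
    using assms
    by (intro exI[of _ "[]"]) (auto simp: pre_digraph.awalk_def cycle_graph_def pre_digraph.cas.simps)
next
  case (Suc k)
  interpret wf_digraph "with_proj (cycle_graph m)" by (rule wf_cycle_graph)
  from Suc obtain p where p: "awalk x p ((x + k) mod m)" "length p = k" by blast
  let ?e = "((x + k) mod m, (x + Suc k) mod m)"
  have "awalk ((x + k) mod m) [?e] ((x + Suc k) mod m)"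
    using assms by (auto simp: pre_digraph.awalk_def pre_digraph.cas.simps cycle_graph_def mod_Suc_eq)
  then have "awalk x (p @ [?e]) ((x + Suc k) mod m)"
    using p by (auto intro: awalk_appendI)
  then show ?case using p by (intro exI[of _ "p @ [?e]"]) auto
qed

lemma awalk_cycle_graph_backward:
  assumes "x < m"
  shows "\<exists>p. pre_digraph.awalk (with_proj (cycle_graph m)) ((x + k) mod m) p x \<and> length p = k"
proof (induction k)
  case 0
  then show ?case
    using assms
    by (intro exI[of _ "[]"]) (auto simp: pre_digraph.awalk_def cycle_graph_def pre_digraph.cas.simps)
next
  case (Suc k)
  interpret wf_digraph "with_proj (cycle_graph m)" by (rule wf_cycle_graph)
  from Suc obtain p where p: "awalk ((x + k) mod m) p x" "length p = k" by blast
  let ?e = "((x + Suc k) mod m, (x + k) mod m)"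
  have "awalk ((x + Suc k) mod m) [?e] ((x + k) mod m)"
    using assms by (auto simp: pre_digraph.awalk_def pre_digraph.cas.simps cycle_graph_def mod_Suc_eq)
  then have "awalk ((x + Suc k) mod m) ([?e] @ p) x"
    using p by (blast intro: awalk_appendI)
  then show ?case using p by (intro exI[of _ "[?e] @ p"]) auto
qed

lemma awalk_cycle_graph_displacement:
  assumes "pre_digraph.awalk (with_proj (cycle_graph m)) x p y"
  shows "\<exists>s::int. \<bar>s\<bar> \<le> int (length p) \<and> (int y - int x) mod int m = s mod int m"
  using assms
proof (induction p arbitrary: x)
  case Nil
  then show ?case
    by (intro exI[of _ 0]) (auto simp: pre_digraph.awalk_def pre_digraph.cas.simps)
next
  case (Cons e p)
  interpret wf_digraph "with_proj (cycle_graph m)" by (rule wf_cycle_graph)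
  obtain z where e: "e = (x, z)" "(x, z) \<in> parcs (cycle_graph m)"
    and w: "awalk z p y"
    using Cons.prems by (cases e) (auto simp: awalk_Cons_iff)
  obtain s :: int where s: "\<bar>s\<bar> \<le> int (length p)"
    "(int y - int z) mod int m = s mod int m"
    using Cons.IH[OF w] by blast
  obtain t :: int where t: "\<bar>t\<bar> \<le> 1" "(int z - int x) mod int m = t mod int m"
  proof -
    from e(2) consider "z = Suc x mod m" | "x = Suc z mod m"
      by (auto simp: cycle_graph_def)
    then show ?thesis
    proof cases
      case 1
      then have "(int z - int x) mod int m = ((int x + 1) - int x) mod int m"
        by (simp add: zmod_int mod_simps add.commute)
      then show ?thesis by (intro that[of 1]) auto
    next
      case 2
      then have "(int z - int x) mod int m = (int z - (int z + 1)) mod int m"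
        by (simp add: zmod_int mod_simps add.commute)
      then show ?thesis by (intro that[of "- 1"]) auto
    qed
  qed
  have "(int y - int x) mod int m = ((int y - int z) + (int z - int x)) mod int m"
    by simp
  also have "\<dots> = (s + t) mod int m"
    using s(2) t(2) by (rule mod_add_cong)
  finally show ?case
    using s(1) t(1) by (intro exI[of _ "s + t"]) auto
qed

lemma graph_dist_cycle_graph:
  assumes "x < m" "y < m"
  shows "graph_dist (cycle_graph m) x y =
    ereal (real (min ((y + m - x) mod m) ((x + m - y) mod m)))"
    (is "_ = ereal (real (min ?a ?b))")
proof -
  interpret wf_digraph "with_proj (cycle_graph m)" by (rule wf_cycle_graph)
  have cost: "awalk_cost (\<lambda>_. 1) p = real (length p)" for p :: "(nat \<times> nat) list"
    by (induction p) auto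
  have a: "int ?a = (int y - int x) mod int m" and b: "int ?b = (int x - int y) mod int m"
    using assms by (simp_all add: zmod_int of_nat_diff add_diff_eq[symmetric] add.commute)
  have lower: "min ?a ?b \<le> length p" if p: "awalk x p y" for p
  proof -
    obtain s :: int where s: "\<bar>s\<bar> \<le> int (length p)"
      "(int y - int x) mod int m = s mod int m"
      using awalk_cycle_graph_displacement[OF p] by blast
    show ?thesis
    proof (cases "s \<ge> 0")
      case True
      then have "int ?a \<le> s" unfolding a s(2) by (rule zmod_le_nonneg_dividend)
      then show ?thesis using s(1) by linarith
    next
      case False
      have "(int x - int y) mod int m = (- s) mod int m"
        using mod_minus_cong[OF s(2)] by simp
      then have "int ?b \<le> - s"
        unfolding b using False zmod_le_nonneg_dividend[of "- s" "int m"] by simp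
      then show ?thesis using s(1) by linarith
    qed
  qed
  have ya: "(x + ?a) mod m = y" and xb: "(y + ?b) mod m = x"
    using assms by (simp_all add: mod_simps)
  obtain p where p: "awalk x p y" "length p = min ?a ?b"
  proof (cases "?a \<le> ?b")
    case True
    then show ?thesis
      using that awalk_cycle_graph_forward[OF assms(1), of ?a] unfolding ya by auto
  next
    case False
    then show ?thesis
      using that awalk_cycle_graph_backward[OF assms(2), of ?b] unfolding xb by auto
  qed
  have "\<mu> (\<lambda>_. 1) x y \<le> ereal (real (min ?a ?b))"
    using min_cost_le_walk_cost[OF p(1), of "\<lambda>_. 1"] unfolding cost p(2) .
  moreover have "ereal (real (min ?a ?b)) \<le> \<mu> (\<lambda>_. 1) x y"
    unfolding \<mu>_def
  proof (rule INF_greatest)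
    fix q assume "q \<in> {q. awalk x q y}"
    then have "min ?a ?b \<le> length q" by (intro lower) simp
    then show "ereal (real (min ?a ?b)) \<le> ereal (awalk_cost (\<lambda>_. 1) q)"
      unfolding cost by (simp only: ereal_less_eq of_nat_le_iff)
  qed
  ultimately show ?thesis
    unfolding graph_dist_def by (rule antisym)
qed

lemma graph_dist_cycle_graph_commute:
  "x < m \<Longrightarrow> y < m \<Longrightarrow>
    graph_dist (cycle_graph m) x y = graph_dist (cycle_graph m) y x"
  by (simp add: graph_dist_cycle_graph min.commute)

lemma pair_graph_circ_graph:
  assumes "1 \<le> r" "r < n"
  shows "pair_graph (circ_graph n r)"
proof -
  have "parcs (circ_graph n r) \<subseteq> {..<2 * n} \<times> {..<2 * n}"
    by (auto simp: circ_graph_def cycle_power_def antipodal_graph_def)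
  then have "finite (parcs (circ_graph n r))"
    by (rule finite_subset) simp
  moreover have "graph_dist (cycle_graph (2 * n)) x x \<noteq> ereal (real n)" if "x < 2 * n" for x
    using that assms by (simp add: graph_dist_cycle_graph)
  ultimately show ?thesis
    by unfold_locales
      (auto simp: circ_graph_def cycle_power_def antipodal_graph_def symmetric_def sym_def
            graph_dist_cycle_graph_commute)
qed

lemma adj_matrix_circ_graph_sum:
  assumes "r < n"
  shows "adj_matrix (circ_graph n r) =
    adj_matrix (cycle_power (2 * n) r) + adj_matrix (antipodal_graph n)"
  using assms
  by (intro eq_matI)
    (auto simp: adj_matrix_def circ_graph_def cycle_power_def antipodal_graph_def
          graph_dist_cycle_graph)

lemma adj_matrix_circ_graph_circulant:
  assumes "1 \<le> r" "r < n"
  shows "adj_matrix (circ_graph n r) = mat (2 * n) (2 * n)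
    (\<lambda>(i, j). ([0] @ replicate r 1 @ replicate (n - r - 1) 0 @ [1] @
               replicate (n - r - 1) 0 @ replicate r 1) ! ((j + 2 * n - i) mod (2 * n)))"
proof (intro eq_matI, goal_cases)
  case (1 i j)
  then have ij: "i < 2 * n" "j < 2 * n" by auto
  define d where "d = (j + 2 * n - i) mod (2 * n)"
  have d: "d < 2 * n" using assms by (simp add: d_def)
  have d0: "d = 0 \<longleftrightarrow> i = j"
  proof (cases "i \<le> j")
    case True
    then have "d = j - i" using ij by (simp add: d_def mod_if)
    then show ?thesis using True by auto
  next
    case False
    then show ?thesis using ij by (simp add: d_def)
  qed
  have d': "(i + 2 * n - j) mod (2 * n) = (if i = j then 0 else 2 * n - d)"
  proof (cases "i \<le> j")
    case True
    then have "d = j - i" using ij by (simp add: d_def mod_if)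
    then show ?thesis using True ij by auto
  next
    case False
    then have "d = j + 2 * n - i" using ij by (simp add: d_def)
    then show ?thesis using False ij by (simp add: mod_if)
  qed
  have adj: "(i, j) \<in> parcs (circ_graph n r) \<longleftrightarrow>
      d \<noteq> 0 \<and> (min d (2 * n - d) \<le> r \<or> min d (2 * n - d) = n)"
    using ij assms d0
    by (auto simp: circ_graph_def cycle_power_def antipodal_graph_def graph_dist_cycle_graph
          d' d_def[symmetric] simp flip: of_nat_diff of_nat_min)
  have "([0] @ replicate r 1 @ replicate (n - r - 1) 0 @ [1] @
         replicate (n - r - 1) 0 @ replicate r 1) ! d =
      (if d \<noteq> 0 \<and> (min d (2 * n - d) \<le> r \<or> min d (2 * n - d) = n) then 1 else (0::real))"
    using assms d by (auto simp: nth_append nth_Cons' min_def)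
  then show ?case
    using ij adj by (simp add: adj_matrix_def circ_graph_def d_def)
qed (simp_all add: adj_matrix_def circ_graph_def)

end

(* The eigenvalue of the circulant matrix at a 2n-th root of unity z is the window sum
   z^(-r) + ... + z^r, minus 1, plus z^n.
   If z^n = 1, it vanishes only if z is a nontrivial common root of unity of the orders n and
   2r + 1. If z^n = -1, it vanishes only if 1 - z^(2r+1) = 2 z^r (1 - z), and this relation passes
   to all conjugates w of z, so that |1 - w| <= 1 for each of them. As the product of the 1 - w is
   a nonzero integer, |1 - z| = 1. Hence z is a primitive sixth root of unity, and
   z^n = z^(2r+1) = -1 makes 3 a common divisor of n and 2r + 1.
   Conversely, for a common divisor d > 1 the d-periodic vector (1, 0, ..., 0, -1) lies in the
   kernel, because its sum over any 2r + 1 consecutive indices is 0. *)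

theory Submission
  imports
    Defs
    "HOL-Computational_Algebra.Polynomial_Factorial"
    "HOL-Computational_Algebra.Fundamental_Theorem_Algebra"
    "Jordan_Normal_Form.Char_Poly"
begin

section \<open>Circulant sums\<close>

lemma periodic_mod:
  fixes f :: "nat \<Rightarrow> 'a"
  assumes "\<And>k. f (k + N) = f k"
  shows "f (k mod N) = f k"
proof -
  have "f (k + m * N) = f k" for k m
  proof (induction m)
    case (Suc m)
    then show ?case using assms[of "k + m * N"] by (simp add: ac_simps)
  qed simp
  from this[of "k mod N" "k div N"] show ?thesis by simp
qed

text \<open>The neighbours of \<open>i\<close> on the cycle together with \<open>i\<close> form a
  window of 2r+1 consecutive residues; \<open>f i\<close> is removed because the diagonal is zero,
  and \<open>f (i + n)\<close> is the antipode. The window starts at \<open>i + 2 * n - r\<close> so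
  that natural subtraction does not truncate. It is applied to a real kernel vector and to the
  powers of a complex root of unity.\<close>

lemma circ_graph_row_sum:
  fixes f :: "nat \<Rightarrow> 'a::real_algebra_1"
  assumes r: "1 \<le> r" "r < n" and i: "i < 2 * n"
    and per: "\<And>k. f (k + 2 * n) = f k"
  shows "(\<Sum>j<2 * n. of_real (adj_matrix (circ_graph n r) $$ (i, j)) * f j) =
    (\<Sum>k<2 * r + 1. f (i + 2 * n - r + k)) - f i + f (i + n)"
proof -
  define N where "N = 2 * n"
  \<comment> \<open>Positions of the ones in the first row: r forward neighbours, the antipode, r
    backward neighbours.\<close>
  define S where "S = {1..r} \<union> {n} \<union> {N - r..<N}"
  define c where "c d = (if d \<in> S then 1 else 0 :: real)" for d
  have per': "f (k + N) = f k" for k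
    using per by (simp add: N_def)
  have coef: "adj_matrix (circ_graph n r) $$ (i, j) = c ((j + N - i) mod N)"
    if "j < N" for j
  proof -
    have "(j + N - i) mod N < N" using r by (simp add: N_def)
    moreover have "([0] @ replicate r 1 @ replicate (n - r - 1) 0 @ [1] @
               replicate (n - r - 1) 0 @ replicate r 1) ! d = c d" if "d < N" for d
      using r that by (auto simp: nth_append nth_Cons' c_def S_def N_def)
    ultimately show ?thesis
      using i that by (simp add: adj_matrix_circ_graph_circulant[OF r] N_def)
  qed
  have "(\<Sum>j<N. of_real (adj_matrix (circ_graph n r) $$ (i, j)) * f j) =
      (\<Sum>d<N. of_real (c d) * f (i + d))"
  proof (rule sum.reindex_bij_witness[where i = "\<lambda>d. (i + d) mod N" and
        j = "\<lambda>j. (j + N - i) mod N"])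
    fix j assume "j \<in> {..<N}"
    then have j: "j < N" by simp
    show inv: "(i + (j + N - i) mod N) mod N = j"
      using i j by (simp add: mod_simps N_def)
    show "(j + N - i) mod N \<in> {..<N}"
      using j by simp
    have "f (i + (j + N - i) mod N) = f j"
      using periodic_mod[of f, OF per', of "i + (j + N - i) mod N"] inv by simp
    then show "of_real (c ((j + N - i) mod N)) * f (i + (j + N - i) mod N) =
        of_real (adj_matrix (circ_graph n r) $$ (i, j)) * f j"
      using coef[OF j] by simp
  next
    fix d assume "d \<in> {..<N}"
    then have d: "d < N" by simp
    then show "(i + d) mod N \<in> {..<N}" by simp
    show "((i + d) mod N + N - i) mod N = d"
    proof (cases "i + d < N")
      case False
      then have "(i + d) mod N = i + d - N"
        using d i by (simp add: N_def mod_if)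
      then show ?thesis using False d i by (simp add: N_def)
    qed (simp add: d)
  qed
  also have "\<dots> = (\<Sum>d\<in>S. f (i + d))"
  proof -
    have "S \<subseteq> {..<N}" using r by (auto simp: S_def N_def)
    then show ?thesis
      by (intro sum.mono_neutral_cong_right) (auto simp: c_def)
  qed
  also have "\<dots> = (\<Sum>d\<in>{1..r}. f (i + d)) + f (i + n) + (\<Sum>d\<in>{N - r..<N}. f (i + d))"
    unfolding S_def using r by (subst sum.union_disjoint, (auto simp: N_def)[3])+ simp
  \<comment> \<open>Position \<open>k\<close> of the window stands for offset \<open>k - r\<close>:
    the forward offsets fill positions r+1 to 2r after a shift by one period, the backward ones fill
    positions 0 to r-1, and position r is \<open>i\<close> itself.\<close>
  also have "(\<Sum>d\<in>{1..r}. f (i + d)) = (\<Sum>k\<in>{r + 1..<2 * r + 1}. f (i + N - r + k))"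
  proof (rule sum.reindex_bij_witness[where i = "\<lambda>k. k - r" and j = "\<lambda>d. d + r"])
    fix d assume d: "d \<in> {1..r}"
    have "i + N - r + (d + r) = i + d + N"
      using r by (simp add: N_def)
    then show "f (i + N - r + (d + r)) = f (i + d)"
      by (simp only: per')
  qed auto
  also have "(\<Sum>d\<in>{N - r..<N}. f (i + d)) = (\<Sum>k<r. f (i + N - r + k))"
    by (rule sum.reindex_bij_witness[where i = "\<lambda>k. N - r + k" and j = "\<lambda>d. d - (N - r)"])
      (use r in \<open>auto simp: N_def\<close>)
  finally have *: "(\<Sum>j<N. of_real (adj_matrix (circ_graph n r) $$ (i, j)) * f j) =
      (\<Sum>k\<in>{r + 1..<2 * r + 1}. f (i + N - r + k)) + f (i + n) + (\<Sum>k<r. f (i + N - r + k))" .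
  have "(\<Sum>k<2 * r + 1. f (i + N - r + k)) =
      (\<Sum>k<r + 1. f (i + N - r + k)) + (\<Sum>k\<in>{r + 1..<2 * r + 1}. f (i + N - r + k))"
    unfolding lessThan_atLeast0 by (rule sum.atLeastLessThan_concat[symmetric]) auto
  also have "f (i + N - r + r) = f i"
    using r per'[of i] by (simp add: N_def)
  then have "(\<Sum>k<r + 1. f (i + N - r + k)) = (\<Sum>k<r. f (i + N - r + k)) + f i"
    by simp
  finally show ?thesis
    using * unfolding N_def by (simp add: algebra_simps)
qed

section \<open>Roots of unity\<close>

text \<open>Gauss's lemma in action: \<open>g\<close> is the primitive part of an annihilator of
  least degree. The pseudo-remainder of \<open>h\<close> by \<open>g\<close> vanishes at
  \<open>z\<close> and has too small a degree to be nonzero; passing to primitive parts then removes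
  the scalar of the pseudo-division. Divisibility over the integers is what later makes
  \<open>g\<close> monic up to sign.\<close>

lemma primitive_annihilator:
  fixes z :: "'a::field_char_0"
  assumes "P \<noteq> 0" and "poly (map_poly of_int P) z = 0"
  obtains g :: "int poly" where "poly (map_poly of_int g) z = 0"
    and "\<And>h :: int poly. poly (map_poly of_int h) z = 0 \<Longrightarrow> g dvd h"
proof -
  define V where "V p \<longleftrightarrow> p \<noteq> 0 \<and> poly (map_poly of_int p) z = 0" for p :: "int poly"
  obtain m where m: "V m" "\<And>p. V p \<Longrightarrow> degree m \<le> degree p"
    using arg_min_natI[of V P degree] arg_min_nat_le[of V _ degree] assms V_def by metis
  define g where "g = primitive_part m"
  have g0: "g \<noteq> 0" and prim: "content g = 1"
    using m(1) by (auto simp: g_def V_def)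
  have "m = smult (content m) g" by (simp add: g_def)
  moreover have "poly (map_poly of_int (smult (content m) g)) z =
      of_int (content m) * poly (map_poly of_int g) z"
    by (simp add: of_int_hom.map_poly_hom_smult)
  ultimately have root: "poly (map_poly of_int g) z = 0"
    using m(1) unfolding V_def by (metis content_eq_zero_iff mult_eq_0_iff of_int_eq_0_iff)
  have "g dvd h" if h: "poly (map_poly of_int h) z = 0" for h :: "int poly"
  proof -
    obtain a q where aq: "a \<noteq> 0" "smult a h = g * q + pseudo_mod h g"
      using pseudo_mod(1)[OF g0] by blast
    have "poly (map_poly of_int (smult a h)) z = poly (map_poly of_int (g * q + pseudo_mod h g)) z"
      using aq(2) by simp
    then have "poly (map_poly of_int (pseudo_mod h g)) z = 0"
      using h root by (simp add: of_int_hom.map_poly_hom_smult of_int_poly_hom.hom_mult of_int_poly_hom.hom_add)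
    then have "pseudo_mod h g = 0"
      using m(2)[of "pseudo_mod h g"] pseudo_mod(2)[OF g0, of h]
      by (auto simp: V_def g_def linorder_not_le[symmetric])
    then have "primitive_part (smult a h) = primitive_part g * primitive_part q"
      using aq(2) by (simp add: primitive_part_mult)
    then have "smult (unit_factor a) (primitive_part h) = g * primitive_part q"
      using prim by (simp add: primitive_part_smult primitive_part_prim)
    then have "g dvd smult (unit_factor a) (primitive_part h)" by simp
    \<comment> \<open>The sign of \<open>a\<close> squares to 1, so multiplying by it a second time
      cancels it.\<close>
    then have "g dvd smult (unit_factor a) (smult (unit_factor a) (primitive_part h))"
      by (rule dvd_smult)
    then have "g dvd primitive_part h"
      using aq(1) by (simp add: sgn_mult_self_eq zsgn_def split: if_splits)
    then have "g dvd smult (content h) (primitive_part h)"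
      by (rule dvd_smult)
    then show ?thesis by simp
  qed
  with root show ?thesis by (rule that)
qed

lemma prod_mset_le_one:
  fixes f :: "'a \<Rightarrow> real"
  assumes "\<And>x. x \<in># M \<Longrightarrow> 0 \<le> f x \<and> f x \<le> 1"
  shows "0 \<le> (\<Prod>x\<in>#M. f x) \<and> (\<Prod>x\<in>#M. f x) \<le> 1"
  using assms by (induction M) (auto intro: mult_le_one)

lemma norm_prod_mset:
  "norm (\<Prod>x\<in>#M. f x :: 'b::{real_normed_field}) = (\<Prod>x\<in>#M. norm (f x))"
  by (induction M) (auto simp: norm_mult)

text \<open>A Kronecker-type argument: the product of the conjugates of \<open>1 - z\<close> is a nonzero integer, while
  each of them lies in the closed unit disc. All conjugates \<open>w\<close> of \<open>z\<close> satisfy the hypotheses of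
  \<open>le\<close> because the minimal polynomial of \<open>z\<close> divides \<open>Q\<close> and \<open>X ^ N - 1\<close>.\<close>
lemma norm_one_minus_eq_one:
  fixes z :: complex and Q :: "int poly"
  assumes N: "N > 0" and z: "z ^ N = 1" "poly (map_poly of_int Q) z = 0"
    and Q1: "poly Q 1 \<noteq> 0"
    and le: "\<And>w :: complex. w ^ N = 1 \<Longrightarrow> poly (map_poly of_int Q) w = 0 \<Longrightarrow> norm (1 - w) \<le> 1"
  shows "norm (1 - z) = 1"
proof -
  define U where "U = (monom 1 N - 1 :: int poly)"
  have evU: "poly (map_poly of_int U) w = w ^ N - 1" for w :: complex
    by (simp add: U_def of_int_poly_hom.hom_minus poly_monom of_int_hom.map_poly_hom_monom)
  have Q0: "Q \<noteq> 0" using Q1 by auto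
  obtain g :: "int poly" where gz: "poly (map_poly of_int g) z = 0"
    and gdvd: "\<And>h :: int poly. poly (map_poly of_int h) z = 0 \<Longrightarrow> g dvd h"
    using primitive_annihilator[OF Q0 z(2)] by blast
  have "g dvd U" by (rule gdvd) (simp add: evU z)
  then obtain u where u: "U = g * u" by (elim dvdE)
  have "g dvd Q" by (rule gdvd) (fact z)
  then obtain q where q: "Q = g * q" by (elim dvdE)
  have "degree U = N"
    unfolding U_def using N degree_add_eq_left[of "-1 :: int poly" "monom 1 N"]
    by (simp add: degree_monom_eq)
  then have "lead_coeff U = 1"
    using N by (simp add: U_def)
  \<comment> \<open>\<open>g\<close> divides the monic \<open>U\<close> over the integers, so its
    leading coefficient is a unit and does not affect the norm of \<open>poly G 1\<close>.\<close>
  then have lead: "\<bar>lead_coeff g\<bar> = 1"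
    unfolding u lead_coeff_mult
    by (metis abs_one abs_zmult_eq_1)
  define G where "G = (map_poly of_int g :: complex poly)"
  have G0: "G \<noteq> 0" using u \<open>lead_coeff U = 1\<close> by (auto simp: G_def)
  have lG: "norm (lead_coeff G) = 1"
    using lead by (simp add: G_def flip: of_int_abs)
  have small: "norm (1 - w) \<le> 1" if "poly G w = 0" for w
  proof (rule le)
    have "poly (map_poly of_int U) w = 0"
      unfolding u using that by (simp add: G_def of_int_poly_hom.hom_mult)
    then show "w ^ N = 1" by (simp add: evU)
    show "poly (map_poly of_int Q) w = 0"
      unfolding q using that by (simp add: G_def of_int_poly_hom.hom_mult)
  qed
  \<comment> \<open>Roots are taken with multiplicity to match the factorization of
    \<open>G\<close>; one copy of \<open>z\<close> is split off, and the remaining factors are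
    bounded by 1.\<close>
  have zr: "z \<in># proots G" using gz G0 by (simp add: G_def)
  then obtain M where M: "proots G = add_mset z M" by (meson multi_member_split)
  have "poly G 1 = of_int (poly g 1)"
    unfolding G_def by (metis of_int_1 of_int_hom.poly_map_poly)
  moreover have "poly g 1 \<noteq> 0" using Q1 q by auto
  ultimately have "1 \<le> norm (poly G 1)"
    by (simp flip: of_int_abs)
  also have "poly G 1 = lead_coeff G * (\<Prod>x\<in>#proots G. 1 - x)"
    by (subst (1) complex_poly_decompose_multiset[symmetric]) (simp add: poly_prod_mset multiset.map_comp comp_def)
  also have "norm \<dots> = norm (1 - z) * (\<Prod>x\<in>#M. norm (1 - x))"
    by (simp only: norm_mult lG norm_prod_mset M) (simp add: norm_mult norm_prod_mset)
  also have "\<dots> \<le> norm (1 - z)"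
  proof (intro mult_right_le_one_le)
    have "poly G x = 0" if "x \<in># M" for x
    proof -
      from that have "x \<in># proots G" unfolding M by simp
      with G0 show ?thesis by simp
    qed
    then have "\<And>x. x \<in># M \<Longrightarrow> 0 \<le> norm (1 - x) \<and> norm (1 - x) \<le> 1"
      using small by simp
    from prod_mset_le_one[of M "\<lambda>x. norm (1 - x)", OF this]
    show "0 \<le> (\<Prod>x\<in>#M. norm (1 - x))" "(\<Prod>x\<in>#M. norm (1 - x)) \<le> 1" by auto
  qed simp
  finally show ?thesis
    using small[of z] gz by (simp add: G_def)
qed

section \<open>Roots of unity solving the window equation\<close>

lemma norm_root_of_unity:
  fixes w :: complex
  assumes "N > 0" "w ^ N = 1"
  shows "norm w = 1"
  using assms by (metis norm_one norm_power norm_ge_zero power_eq_1_iff less_irrefl)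

lemma one_minus_power_window:
  fixes w :: complex and r :: nat
  assumes "(\<Sum>k<2 * r + 1. w ^ k) = 2 * w ^ r"
  shows "1 - w ^ (2 * r + 1) = 2 * w ^ r * (1 - w)"
  using one_diff_power_eq[of w "2 * r + 1"] assms by (simp only: mult.commute)

text \<open>Every root of unity \<open>w\<close> solving the equation satisfies 2|1 - w| = |1 -
  w^(2r+1)| \<le> 2, so \<open>norm_one_minus_eq_one\<close> gives |1 - z| = 1. This fixes
  \<open>z\<close> up to complex conjugation and turns the inequality for \<open>z\<close> into an
  equality.\<close>

lemma window_eq_twice_middle:
  fixes z :: complex and r :: nat
  assumes N: "N > 0" and z: "z ^ N = 1" and sum: "(\<Sum>k<2 * r + 1. z ^ k) = 2 * z ^ r"
  shows "z ^ 2 = z - 1" and "z ^ (2 * r + 1) = - 1"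
proof -
  \<comment> \<open>The equation is written as an integer polynomial so that it passes to the
    conjugates of \<open>z\<close>.\<close>
  define Q where "Q = (\<Sum>k<2 * r + 1. monom 1 k) - monom (2 :: int) r"
  have ev: "poly (map_poly of_int Q) w = (\<Sum>k<2 * r + 1. w ^ k) - 2 * w ^ r" for w :: complex
    unfolding Q_def
    by (simp only: of_int_poly_hom.hom_minus of_int_poly_hom.hom_sum of_int_hom.map_poly_hom_monom)
      (simp add: poly_sum poly_monom)
  have le: "norm (1 - w) \<le> 1" if w: "w ^ N = 1" "poly (map_poly of_int Q) w = 0" for w :: complex
  proof -
    have "2 * norm (1 - w) = norm (2 * w ^ r * (1 - w))"
      using norm_root_of_unity[OF N w(1)] by (simp add: norm_mult norm_power)
    also have "\<dots> = norm (1 - w ^ (2 * r + 1))"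
      using w(2) one_minus_power_window[of w r] unfolding ev by simp
    also have "\<dots> \<le> norm (1::complex) + norm (w ^ (2 * r + 1))"
      by (rule norm_triangle_ineq4)
    finally show ?thesis
      using norm_root_of_unity[OF N w(1)] by (simp only: norm_power) simp
  qed
  \<comment> \<open>The value at 1 is (2r+1) - 2, an odd number, hence nonzero.\<close>
  have "poly Q 1 = 2 * int r - 1"
    by (simp add: Q_def poly_sum poly_monom)
  then have "poly Q 1 \<noteq> 0" by presburger
  then have n1: "norm (1 - z) = 1"
    using sum by (intro norm_one_minus_eq_one[where Q = Q, OF N z _ _ le]) (simp_all add: ev)
  have nz: "norm z = 1" by (rule norm_root_of_unity[OF N z])
  \<comment> \<open>The unit circles around 0 and 1 meet where the real part is 1/2.\<close>
  have circ: "(Re z)\<^sup>2 + (Im z)\<^sup>2 = 1" "(1 - Re z)\<^sup>2 + (Im z)\<^sup>2 = 1"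
    using nz n1 by (simp_all add: cmod_def)
  then have re: "Re z = 1 / 2" by (simp add: power2_eq_square algebra_simps)
  have "Im z * Im z = 3 / 4"
    using circ(1) unfolding re by (simp add: power2_eq_square)
  then show "z ^ 2 = z - 1"
    by (simp add: complex_eq_iff power2_eq_square re)
  \<comment> \<open>\<open>1 - w\<close> has the largest norm possible for a point \<open>w\<close>
    of the unit circle, which is attained only at -1.\<close>
  define w where "w = z ^ (2 * r + 1)"
  have "norm (1 - w) = 2" "norm w = 1"
    unfolding w_def using one_minus_power_window[OF sum] n1 nz
    by (simp_all only: norm_mult norm_power) simp_all
  then have circw: "(1 - Re w)\<^sup>2 + (Im w)\<^sup>2 = 4" "(Re w)\<^sup>2 + (Im w)\<^sup>2 = 1"
    using real_sqrt_eq_iff[of _ 4] by (simp_all add: cmod_def)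
  then have re_w: "Re w = - 1"
    by (simp add: power2_eq_square algebra_simps)
  with circw(2) have "Im w = 0" by simp
  with re_w show "z ^ (2 * r + 1) = - 1"
    unfolding w_def[symmetric] by (simp add: complex_eq_iff)
qed

text \<open>The quadratic relation gives \<open>z ^ 3 = - 1\<close>. A nonzero residue of
  \<open>m\<close> mod 3 would make z or z^2 = z - 1 equal to 1 or -1, against the same
  relation.\<close>

lemma three_dvd_exponent:
  fixes z :: complex
  assumes z2: "z ^ 2 = z - 1" and m: "z ^ m = - 1"
  shows "3 dvd m"
proof -
  have "z ^ 3 = z * z ^ 2" by (simp add: power3_eq_cube power2_eq_square)
  also have "\<dots> = - 1" unfolding z2 using z2 by (simp add: algebra_simps power2_eq_square)
  finally have z3: "z ^ 3 = - 1" .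
  have "z ^ m = (z ^ 3) ^ (m div 3) * z ^ (m mod 3)"
    by (simp flip: power_mult power_add)
  then have e: "(- 1) ^ (m div 3) * z ^ (m mod 3) = - 1"
    using m z3 by simp
  have pm: "z ^ (m mod 3) = 1 \<or> z ^ (m mod 3) = - 1"
    using e by (cases "even (m div 3)") auto
  consider "m mod 3 = 0" | "m mod 3 = 1" | "m mod 3 = 2" by linarith
  then show ?thesis
  proof cases
    case 2
    then have "z = 1 \<or> z = - 1" using pm by simp
    then show ?thesis using z2 by auto
  next
    case 3
    then have "z - 1 = 1 \<or> z - 1 = - 1" using pm z2 by simp
    then have "z = 2 \<or> z = 0" by (auto simp: algebra_simps)
    then show ?thesis using z2 by auto
  qed auto
qed

section \<open>From a vanishing eigenvalue to the gcd\<close>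

lemma power_gcd_eq_one:
  fixes z :: "'a::field"
  assumes "z ^ a = 1" "z ^ b = 1"
  shows "z ^ gcd a b = 1"
proof (cases "a = 0")
  case False
  then obtain x y where "a * x = b * y + gcd a b" using bezout_nat by blast
  then have "z ^ (a * x) = z ^ (b * y) * z ^ gcd a b" by (simp add: power_add)
  then show ?thesis using assms by (simp add: power_mult)
qed (use assms in simp)

lemma vanishing_eigenvalue_imp_gcd:
  fixes z :: complex
  assumes r: "1 \<le> r" "r < n" and z: "z ^ (2 * n) = 1"
    and L: "z ^ (2 * n - r) * (\<Sum>k<2 * r + 1. z ^ k) - 1 + z ^ n = 0"
  shows "3 \<le> gcd n (2 * r + 1)"
proof -
  have z0: "z \<noteq> 0" using z r by (auto simp: power_0_left)
  have gpos: "gcd n (2 * r + 1) \<noteq> 0" by simp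
  have "(z ^ n)\<^sup>2 = 1" using z by (metis mult.commute power_mult)
  then consider "z ^ n = 1" | "z ^ n = - 1" by (auto simp: power2_eq_1_iff)
  then show ?thesis
  proof cases
    case 1
    then have S: "(\<Sum>k<2 * r + 1. z ^ k) = 0" using L z0 by simp
    have "z \<noteq> 1"
    proof
      assume "z = 1"
      then have "(\<Sum>k<2 * r + 1. z ^ k) = of_nat (2 * r + 1)" by simp
      then show False using S of_nat_eq_0_iff[where 'a = complex, of "2 * r + 1"] by simp
    qed
    moreover have "z ^ (2 * r + 1) = 1"
      using one_diff_power_eq[of z "2 * r + 1"] S by simp
    ultimately have "gcd n (2 * r + 1) \<noteq> 1"
      using power_gcd_eq_one[OF 1] by (metis power_one_right)
    \<comment> \<open>As a divisor of 2r+1 the gcd cannot be 2, so differing from 1 already means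
      being at least 3.\<close>
    moreover have "odd (gcd n (2 * r + 1))"
      using dvd_trans[of 2 "gcd n (2 * r + 1)" "2 * r + 1"] by auto
    moreover have "3 \<le> m" if "m \<noteq> 0" "m \<noteq> 1" "odd m" for m :: nat
      using that by presburger
    ultimately show ?thesis using gpos by blast
  next
    case 2
    \<comment> \<open>\<open>z ^ (2 * n - r)\<close> is the inverse of \<open>z ^ r\<close>;
      multiplying by \<open>z ^ r\<close> brings the vanishing eigenvalue into the form of the
      window equation.\<close>
    have "z ^ (2 * n - r) * z ^ r = 1" using z r by (simp flip: power_add)
    moreover have "z ^ (2 * n - r) * (\<Sum>k<2 * r + 1. z ^ k) = 2"
      using L 2 by (simp add: algebra_simps)
    ultimately have "z ^ (2 * n - r) * (\<Sum>k<2 * r + 1. z ^ k) = z ^ (2 * n - r) * (2 * z ^ r)"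
      by (simp add: algebra_simps)
    then have S: "(\<Sum>k<2 * r + 1. z ^ k) = 2 * z ^ r" using z0 by simp
    have "2 * n > 0" using r by simp
    from window_eq_twice_middle[OF this z S] 2
    have "3 dvd n" "3 dvd 2 * r + 1"
      using three_dvd_exponent by blast+
    then have "3 dvd gcd n (2 * r + 1)" by simp
    then show ?thesis by (rule dvd_imp_le) simp
  qed
qed

section \<open>Singularity\<close>

lemma adj_matrix_circ_graph_carrier:
  "adj_matrix (circ_graph n r) \<in> carrier_mat (2 * n) (2 * n)"
  by (simp add: adj_matrix_def circ_graph_def)

lemma invertible_mat_iff_det:
  fixes A :: "'a::field mat"
  assumes A: "A \<in> carrier_mat n n"
  shows "invertible_mat A \<longleftrightarrow> det A \<noteq> 0"
proof
  assume "invertible_mat A"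
  then obtain B where AB: "A * B = 1\<^sub>m (dim_row A)" and BA: "B * A = 1\<^sub>m (dim_row B)"
    by (auto simp: invertible_mat_def inverts_mat_def)
  \<comment> \<open>\<open>invertible_mat\<close> leaves the shape of the inverse open; the two
    product identities determine it.\<close>
  have "dim_col B = n"
    using arg_cong[OF AB, of dim_col] A by simp
  moreover have "dim_row B = n"
    using arg_cong[OF BA, of dim_col] A by simp
  ultimately have B: "B \<in> carrier_mat n n" by auto
  then have "det A * det B = 1"
    using det_mult[OF A B] AB A by simp
  then show "det A \<noteq> 0" by auto
next
  assume "det A \<noteq> 0"
  from det_non_zero_imp_unit[OF A this, of "()"]
  obtain B where "B \<in> carrier_mat n n" "B * A = 1\<^sub>m n" "A * B = 1\<^sub>m n"
    by (auto simp: Units_def ring_mat_def)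
  then show "invertible_mat A"
    using A by (auto simp: invertible_mat_def inverts_mat_def)
qed

text \<open>The kernel vector is a difference of consecutive values of the indicator of the
  multiples of \<open>d\<close>. Its window sums telescope to a difference at distance 2r+1, which
  is 0 by periodicity, and \<open>d dvd n\<close> makes the antipodal term cancel the diagonal
  correction. Since d > 1, its entry at 0 is 1.\<close>

lemma singular_graph_if_common_divisor:
  assumes r: "1 \<le> r" "r < n" and d: "1 < d" "d dvd n" "d dvd 2 * r + 1"
  shows "singular_graph (circ_graph n r)"
proof -
  define A where "A = adj_matrix (circ_graph n r)"
  have A: "A \<in> carrier_mat (2 * n) (2 * n)"
    unfolding A_def by (rule adj_matrix_circ_graph_carrier)
  define u where "u k = (if d dvd k then 1 else 0 :: real)" for k
  define f where "f k = u k - u (Suc k)" for k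
  have u: "u (k + m) = u k" if "d dvd m" for k m
    using that by (simp add: u_def dvd_add_left_iff)
  have f: "f (k + m) = f k" if "d dvd m" for k m
    using u[OF that, of k] u[OF that, of "Suc k"] by (simp add: f_def)
  define v where "v = vec (2 * n) f"
  have "A *\<^sub>v v = 0\<^sub>v (2 * n)"
  proof (intro eq_vecI)
    fix i assume "i < dim_vec (0\<^sub>v (2 * n) :: real vec)"
    then have i: "i < 2 * n" by simp
    have "(A *\<^sub>v v) $ i = (\<Sum>j<2 * n. A $$ (i, j) * f j)"
      using A i by (simp add: scalar_prod_def v_def lessThan_atLeast0)
    also have "\<dots> = (\<Sum>k<2 * r + 1. f (i + 2 * n - r + k)) - f i + f (i + n)"
      using circ_graph_row_sum[OF r i, of f] f[of "2 * n"] d(2) unfolding A_def by simp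
    also have "f (i + n) = f i" using f d(2) by simp
    also have "(\<Sum>k<2 * r + 1. f (i + 2 * n - r + k)) =
        u (i + 2 * n - r) - u (i + 2 * n - r + (2 * r + 1))"
      using sum_lessThan_telescope'[of "\<lambda>k. u (i + 2 * n - r + k)" "2 * r + 1"]
      by (simp add: f_def)
    also have "\<dots> = 0" using u[OF d(3)] by simp
    finally show "(A *\<^sub>v v) $ i = 0\<^sub>v (2 * n) $ i" using i by simp
  qed (use A in simp)
  moreover have "v \<noteq> 0\<^sub>v (2 * n)"
  proof
    assume "v = 0\<^sub>v (2 * n)"
    then have "v $ 0 = 0" using r by simp
    then show False using r d(1) by (simp add: v_def f_def u_def)
  qed
  moreover have "v \<in> carrier_vec (2 * n)" by (simp add: v_def)
  ultimately have "det A = 0" using det_0_iff_vec_prod_zero[OF A] by blast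
  then show ?thesis
    using invertible_mat_iff_det[OF A] by (simp add: singular_graph_def A_def)
qed

lemma singular_graph_vanishing_eigenvalue:
  assumes r: "1 \<le> r" "r < n" and sing: "singular_graph (circ_graph n r)"
  obtains z :: complex where "z ^ (2 * n) = 1"
    and "z ^ (2 * n - r) * (\<Sum>k<2 * r + 1. z ^ k) - 1 + z ^ n = 0"
proof (rule ccontr)
  assume neg: "\<not> thesis"
  note witness = that
  define A where "A = adj_matrix (circ_graph n r)"
  have A: "A \<in> carrier_mat (2 * n) (2 * n)"
    unfolding A_def by (rule adj_matrix_circ_graph_carrier)
  \<comment> \<open>The transpose yields a left kernel vector, which can be paired with the
    eigenvectors (z^j) of \<open>A\<close>.\<close>
  have "det (transpose_mat A) = 0"
    using sing invertible_mat_iff_det[OF A] det_transpose[OF A]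
    by (simp add: singular_graph_def A_def)
  then obtain v where v: "v \<in> carrier_vec (2 * n)" "v \<noteq> 0\<^sub>v (2 * n)"
    and Av: "transpose_mat A *\<^sub>v v = 0\<^sub>v (2 * n)"
    using det_0_iff_vec_prod_zero[of "transpose_mat A" "2 * n"] A by auto
  have col: "(\<Sum>i<2 * n. A $$ (i, j) * v $ i) = 0" if "j < 2 * n" for j
    using arg_cong[OF Av, of "\<lambda>w. w $ j"] that A v(1)
    by (simp add: scalar_prod_def lessThan_atLeast0)
  define p where "p = (\<Sum>i<2 * n. monom (complex_of_real (v $ i)) i)"
  have "poly p z = 0" if z: "z ^ (2 * n) = 1" for z
  proof -
    define L where "L = z ^ (2 * n - r) * (\<Sum>k<2 * r + 1. z ^ k) - 1 + z ^ n"
    have row: "(\<Sum>j<2 * n. of_real (A $$ (i, j)) * z ^ j) = L * z ^ i" if i: "i < 2 * n" for i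
    proof -
      have "(\<Sum>j<2 * n. of_real (A $$ (i, j)) * z ^ j) =
          (\<Sum>k<2 * r + 1. z ^ (i + 2 * n - r + k)) - z ^ i + z ^ (i + n)"
        unfolding A_def by (rule circ_graph_row_sum[OF r i]) (simp add: power_add z)
      also have "(\<Sum>k<2 * r + 1. z ^ (i + 2 * n - r + k)) =
          z ^ i * z ^ (2 * n - r) * (\<Sum>k<2 * r + 1. z ^ k)"
        unfolding sum_distrib_left
      proof (rule sum.cong)
        fix k
        have "i + 2 * n - r + k = i + (2 * n - r) + k" using r by simp
        then show "z ^ (i + 2 * n - r + k) = z ^ i * z ^ (2 * n - r) * z ^ k"
          by (simp only: power_add)
      qed simp
      finally show ?thesis by (simp add: L_def algebra_simps power_add)
    qed
    \<comment> \<open>The double sum is evaluated in two ways: by columns it is 0 because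
      \<open>v\<close> is a left kernel vector, by rows it is \<open>L * poly p z\<close> because
      (z^j) is an eigenvector with eigenvalue \<open>L\<close>.\<close>
    have "0 = (\<Sum>j<2 * n. of_real (\<Sum>i<2 * n. A $$ (i, j) * v $ i) * z ^ j)"
      using col by simp
    also have "\<dots> = (\<Sum>j<2 * n. \<Sum>i<2 * n. of_real (v $ i) * (of_real (A $$ (i, j)) * z ^ j))"
      by (simp add: sum_distrib_left mult_ac)
    also have "\<dots> = (\<Sum>i<2 * n. \<Sum>j<2 * n. of_real (v $ i) * (of_real (A $$ (i, j)) * z ^ j))"
      by (rule sum.swap)
    also have "\<dots> = (\<Sum>i<2 * n. of_real (v $ i) * (L * z ^ i))"
      by (intro sum.cong refl) (simp add: row flip: sum_distrib_left)
    also have "\<dots> = L * poly p z"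
      by (simp add: p_def poly_sum poly_monom sum_distrib_left mult_ac)
    finally have "L * poly p z = 0" by simp
    moreover have "L \<noteq> 0" unfolding L_def using neg witness[OF z] by blast
    ultimately show ?thesis by simp
  qed
  then have sub: "{z. z ^ (2 * n) = 1} \<subseteq> {z. poly p z = 0}" by auto
  have deg: "degree p < 2 * n"
    unfolding p_def using r
    by (intro degree_sum_less) (auto intro: le_less_trans[OF degree_monom_le])
  have "p = 0"
  proof (rule ccontr)
    assume p: "p \<noteq> 0"
    have "2 * n = card {z :: complex. z ^ (2 * n) = 1}"
      using r by (simp add: card_roots_unity_eq)
    also have "\<dots> \<le> card {z. poly p z = 0}"
      using sub by (intro card_mono poly_roots_finite p)
    also have "\<dots> \<le> degree p" by (rule card_poly_roots_bound[OF p])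
    finally show False using deg by simp
  qed
  have "v $ i = 0" if "i < 2 * n" for i
  proof -
    have "coeff p i = of_real (v $ i)"
      using that by (simp add: p_def coeff_sum)
    then show ?thesis using \<open>p = 0\<close> by simp
  qed
  then have "v = 0\<^sub>v (2 * n)" using v(1) by (intro eq_vecI) auto
  with v(2) show False by simp
qed

theorem theorem20:
  fixes n r :: nat
  assumes "1 \<le> r" and "r < n"
  shows "singular_graph (circ_graph n r) \<longleftrightarrow> gcd n (2 * r + 1) \<ge> 3"
proof
  assume "singular_graph (circ_graph n r)"
  then show "gcd n (2 * r + 1) \<ge> 3"
    using singular_graph_vanishing_eigenvalue[OF assms] vanishing_eigenvalue_imp_gcd[OF assms]
    by blast
next
  assume "gcd n (2 * r + 1) \<ge> 3"
  then show "singular_graph (circ_graph n r)"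
    by (intro singular_graph_if_common_divisor[OF assms, of "gcd n (2 * r + 1)"]) auto
qed

end
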